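(* $n_6(4) \leq 66$; that is, there exists a graph on $66$ vertices with chromatic number $4$ and girth at least $6$.
   Context: All graphs are finite and simple. The girth of a graph is the length of its shortest cycle. For integers $g$ and $k$, $n_g(k)$ denotes the smallest order of a graph with chromatic number exactly $k$ and girth at least $g$. *)

theory Defs
  imports Main "HOL-Library.Extended_Nat"
begin

definition simple_graph :: "'a set \<Rightarrow> 'a set set \<Rightarrow> bool" where
  "simple_graph V E \<longleftrightarrow> finite V \<and> (\<forall>e\<in>E. e \<subseteq> V \<and> card e = 2)"

text \<open>A cycle is given by its vertices in cyclic order, without repeating the first one at the
  end, so that the length of the list is the length of the cycle.\<close>

definition is_cycle :: "'a set \<Rightarrow> 'a set set \<Rightarrow> 'a list \<Rightarrow> bool" where
  "is_cycle V E c \<longleftrightarrow> 3 \<le> length c \<and> distinct c \<and> set c \<subseteq> V \<and>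
     (\<forall>i<length c. {c ! i, c ! (Suc i mod length c)} \<in> E)"

text \<open>The infimum of the empty set is \<open>\<infinity>\<close>, so acyclic graphs have infinite girth.\<close>

definition girth :: "'a set \<Rightarrow> 'a set set \<Rightarrow> enat" where
  "girth V E = Inf {enat (length c) | c. is_cycle V E c}"

definition proper_colouring :: "'a set \<Rightarrow> 'a set set \<Rightarrow> nat \<Rightarrow> ('a \<Rightarrow> nat) \<Rightarrow> bool" where
  "proper_colouring V E k f \<longleftrightarrow>
     (\<forall>v\<in>V. f v < k) \<and> (\<forall>u\<in>V. \<forall>v\<in>V. {u, v} \<in> E \<longrightarrow> f u \<noteq> f v)"

definition chromatic_number :: "'a set \<Rightarrow> 'a set set \<Rightarrow> nat" where
  "chromatic_number V E = (LEAST k. \<exists>f. proper_colouring V E k f)"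

text \<open>Every finite graph is isomorphic to one whose vertices are natural numbers.  The value is
  unspecified if no graph with the required chromatic number and girth exists.\<close>

definition min_order :: "nat \<Rightarrow> nat \<Rightarrow> nat" where
  "min_order g k = (LEAST n. \<exists>(V :: nat set) E. simple_graph V E \<and> card V = n \<and>
     chromatic_number V E = k \<and> enat g \<le> girth V E)"

end

theory Submission
  imports Defs
begin

text \<open>The witness has vertices \<open>11 i + x\<close> with \<open>i < 6\<close> and \<open>x\<close> in \<open>\<int>/11\<close>, and is invariant
  under \<open>x \<mapsto> x + 1\<close>; it was found by a computer search over such graphs.  An entry \<open>(k, d)\<close> in
  row \<open>i\<close> of the table below stands for the 11 edges joining \<open>11 i + x\<close> to \<open>11 k + (x + d)\<close>, so
  every edge orbit occurs once from each side and the graph is 5-regular.  It has no cycle of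
  length at most 5 because, around every vertex, the 1 + 5 + 20 vertices of the first two
  neighbourhoods are distinct and no edge joins two second neighbours.  After naming two colours
  by the ends of an edge, 3-colourability is a propositional problem that resolution refutes.\<close>

definition connections :: "(nat \<times> nat) list list" where
  "connections =
   [[(1, 0), (2, 0), (2, 9), (3, 10), (4, 5)],
    [(0, 0), (1, 1), (1, 10), (2, 3), (3, 7)],
    [(0, 0), (0, 2), (1, 8), (3, 0), (4, 0)],
    [(0, 1), (1, 4), (2, 0), (5, 0), (5, 6)],
    [(0, 6), (2, 0), (4, 1), (4, 10), (5, 3)],
    [(3, 0), (3, 5), (4, 8), (5, 4), (5, 7)]]"

definition neighbours :: "nat \<Rightarrow> nat list" where
  "neighbours u = map (\<lambda>(k, d). 11 * k + (u + d) mod 11) (connections ! (u div 11))"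

definition edges66 :: "nat set set" where
  "edges66 = {{u, v} | u v. u < 66 \<and> v \<in> set (neighbours u)}"

text \<open>Colour \<open>3\<close> occurs at vertex \<open>64\<close> alone, so deleting that
  vertex leaves a 3-colourable graph.\<close>

definition colour :: "nat \<Rightarrow> nat" where
  "colour v =
   [0, 1, 0, 1, 0, 1, 0, 0, 1, 0, 1,
    1, 0, 1, 0, 1, 0, 1, 2, 0, 2, 0,
    2, 0, 1, 0, 1, 2, 2, 2, 2, 2, 0,
    0, 2, 0, 1, 2, 1, 1, 0, 1, 0, 1,
    1, 2, 0, 1, 0, 1, 0, 1, 0, 1, 2,
    2, 0, 1, 2, 1, 2, 2, 1, 2, 3, 0] ! v"

text \<open>The list keeps multiplicities: the far corner of a 4-cycle through \<open>u\<close> is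
  reached by two neighbours, appears twice and so breaks distinctness. \<open>remove1\<close> drops
  the step back to \<open>u\<close>.\<close>

definition second_neighbours :: "nat \<Rightarrow> nat list" where
  "second_neighbours u = concat (map (\<lambda>v. remove1 u (neighbours v)) (neighbours u))"

lemma neighbours_sym_and_colour:
  "list_all (\<lambda>u. list_all (\<lambda>v. v < 66 \<and> u \<noteq> v \<and> u \<in> set (neighbours v)
     \<and> colour u \<noteq> colour v) (neighbours u) \<and> colour u < 4) [0..<66]"
  by code_simp

lemma neighbourhoods_distinct:
  "list_all (\<lambda>u. distinct (u # neighbours u @ second_neighbours u)) [0..<66]"
  by code_simp

lemma second_neighbours_independent:
  "list_all (\<lambda>u. let S = second_neighbours u in
     list_all (\<lambda>w. list_all (\<lambda>x. x \<notin> set S) (neighbours w)) S) [0..<66]"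
  by code_simp

lemma neighboursD:
  assumes "u < 66" "v \<in> set (neighbours u)"
  shows "v < 66" "u \<noteq> v" "u \<in> set (neighbours v)" "colour u \<noteq> colour v"
proof -
  have "u \<in> set [0..<66]" using assms by simp
  then show "v < 66" "u \<noteq> v" "u \<in> set (neighbours v)" "colour u \<noteq> colour v"
    using neighbours_sym_and_colour[unfolded list_all_iff] assms(2) by blast+
qed

lemma colour_less: "u < 66 \<Longrightarrow> colour u < 4"
  using neighbours_sym_and_colour[unfolded list_all_iff set_upt] by fastforce

lemma distinct_concat_map_unique:
  assumes "distinct (concat (map F xs))" "x \<in> set xs" "y \<in> set xs" "z \<in> set (F x)" "z \<in> set (F y)"
  shows "x = y"
  using assms by (induction xs) auto

text \<open>The three parts rule out cycles through \<open>u\<close> of length 3, 4 and 5, in this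
  order.\<close>

lemma neighbourhoodsD:
  assumes "u < 66"
  shows "set (neighbours u) \<inter> set (second_neighbours u) = {}"
    and "\<lbrakk>v \<in> set (neighbours u); w \<in> set (neighbours u); x \<in> set (neighbours v);
      x \<in> set (neighbours w); x \<noteq> u\<rbrakk> \<Longrightarrow> v = w"
    and "\<lbrakk>w \<in> set (second_neighbours u); x \<in> set (neighbours w)\<rbrakk>
      \<Longrightarrow> x \<notin> set (second_neighbours u)"
proof -
  have *: "distinct (u # neighbours u @ second_neighbours u)"
    using neighbourhoods_distinct assms by (simp add: list_all_iff)
  then show "set (neighbours u) \<inter> set (second_neighbours u) = {}" by auto
  show "v = w" if "v \<in> set (neighbours u)" "w \<in> set (neighbours u)" "x \<in> set (neighbours v)"
    "x \<in> set (neighbours w)" "x \<noteq> u"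
    using * that distinct_concat_map_unique[of "\<lambda>v. remove1 u (neighbours v)" "neighbours u" v w x]
    by (simp add: second_neighbours_def)
  show "x \<notin> set (second_neighbours u)" if "w \<in> set (second_neighbours u)" "x \<in> set (neighbours w)"
    using second_neighbours_independent[unfolded list_all_iff set_upt Let_def] assms that
    by fastforce
qed

text \<open>The condition \<open>u < v\<close> keeps one orientation, so each of the 165 edges
  contributes its clauses once.\<close>

definition edge_list :: "(nat \<times> nat) list" where
  "edge_list = [(u, v). u \<leftarrow> [0..<66], v \<leftarrow> neighbours u, u < v]"

lemma vertex_list_eval:
  "[0..<66] =
  [0, 1, 2, 3, 4, 5, 6, 7, 8, 9, 10, 11, 12, 13, 14, 15, 16, 17, 18, 19, 20, 21,
   22, 23, 24, 25, 26, 27, 28, 29, 30, 31, 32, 33, 34, 35, 36, 37, 38, 39, 40, 41, 42, 43,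
   44, 45, 46, 47, 48, 49, 50, 51, 52, 53, 54, 55, 56, 57, 58, 59, 60, 61, 62, 63, 64, 65]"
  by code_simp

text \<open>Simplification turns \<open>1\<close> into \<open>Suc 0\<close>; folding restores the
  numeral, so that atoms such as \<open>p 1\<close> agree syntactically with those from
  \<open>vertex_list_eval\<close>.\<close>

lemmas edge_list_eval =
  edge_list_def[unfolded vertex_list_eval neighbours_def connections_def,
    simplified, folded One_nat_def]

lemma not_three_colourable:
  fixes f :: "nat \<Rightarrow> nat"
  assumes less: "\<And>v. v < 66 \<Longrightarrow> f v < 3"
    and neq: "\<And>u v. u < 66 \<Longrightarrow> v \<in> set (neighbours u) \<Longrightarrow> f u \<noteq> f v"
  shows False
proof -
  \<comment> \<open>The adjacent vertices \<open>0\<close> and \<open>11\<close> have different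
    colours; \<open>p\<close> and \<open>q\<close> stand for these, \<open>r\<close> for the
    remaining one. This breaks the symmetry between colours.\<close>
  define p where "p v \<longleftrightarrow> f v = f 0" for v
  define q where "q v \<longleftrightarrow> f v = f 11" for v
  define r where "r v \<longleftrightarrow> f v \<noteq> f 0 \<and> f v \<noteq> f 11" for v
  have base: "f 0 \<noteq> f 11" "f 0 < 3" "f 11 < 3"
    using neq[of 0 11] less by (simp_all add: neighbours_def connections_def)
  have start: "p 0" "q 11"
    by (simp_all add: p_def q_def)
  have some_colour: "list_all (\<lambda>v. p v \<or> q v \<or> r v) [0..<66]"
    by (auto simp: list_all_iff p_def q_def r_def)
  \<comment> \<open>For \<open>r\<close> the bound matters: below 3 only one value differs from both
    \<open>f 0\<close> and \<open>f 11\<close>, so two vertices satisfying \<open>r\<close> have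
    equal colours.\<close>
  have "(\<not> p u \<or> \<not> p v) \<and> (\<not> q u \<or> \<not> q v) \<and> (\<not> r u \<or> \<not> r v)"
    if "(u, v) \<in> set edge_list" for u v
  proof -
    from that have uv: "u < 66" "v \<in> set (neighbours u)" by (auto simp: edge_list_def)
    then have "v < 66" using neighboursD by blast
    then show ?thesis
      using neq[OF uv] less[of u] less[of v] base \<open>u < 66\<close> unfolding p_def q_def r_def by linarith
  qed
  then have no_conflict: "list_all (\<lambda>(u, v).
      (\<not> p u \<or> \<not> p v) \<and> (\<not> q u \<or> \<not> q v) \<and> (\<not> r u \<or> \<not> r v)) edge_list"
    by (auto simp: list_all_iff)
  \<comment> \<open>Unfolding the lists leaves conjunctions of clauses over the atoms
    \<open>p v\<close>, \<open>q v\<close>, \<open>r v\<close> with literal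
    \<open>v\<close>.\<close>
  from start some_colour[unfolded vertex_list_eval list.pred_inject]
    no_conflict[unfolded edge_list_eval list.pred_inject prod.case]
  show False by sat
qed

lemma edges66_iff: "{u, v} \<in> edges66 \<longleftrightarrow> u < 66 \<and> v \<in> set (neighbours u)"
  unfolding edges66_def by (auto simp: doubleton_eq_iff dest: neighboursD(1,3))

lemma girth_edges66: "6 \<le> girth {..<66} edges66"
proof -
  have "6 \<le> length c" if c: "is_cycle {..<66} edges66 c" for c
  proof (rule ccontr)
    assume "\<not> 6 \<le> length c"
    with c have len: "length c \<in> {3, 4, 5}" and dist: "distinct c"
      by (auto simp: is_cycle_def)
    \<comment> \<open>With \<open>j\<close> as a separate variable, the closing edge from the last
      vertex back to index \<open>0\<close> is an ordinary instance.\<close>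
    have edge: "c ! j \<in> set (neighbours (c ! i))"
      and edge': "c ! i \<in> set (neighbours (c ! j))"
      if "i < length c" "j = Suc i mod length c" for i j
      using c that by (auto simp: is_cycle_def edges66_iff dest: neighboursD(3))
    have "c ! 0 \<in> set c" using len by (intro nth_mem) auto
    then have "c ! 0 < 66" using c by (auto simp: is_cycle_def)
    let ?u = "c ! 0"
    have second: "w \<in> set (second_neighbours ?u)"
      if "v \<in> set (neighbours ?u)" "w \<in> set (neighbours v)" "w \<noteq> ?u" for v w
      using that by (auto simp: second_neighbours_def)
    note d = neighbourhoodsD[OF \<open>?u < 66\<close>]
    from len consider "length c = 3" | "length c = 4" | "length c = 5" by auto
    then show False
    proof cases
      case 1
      with dist have "c ! 2 \<noteq> ?u" by (simp add: nth_eq_iff_index_eq)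
      moreover have "c ! 1 \<in> set (neighbours ?u)" "c ! 2 \<in> set (neighbours (c ! 1))"
        "c ! 2 \<in> set (neighbours ?u)"
        using edge[of 0 1] edge[of 1 2] edge'[of 2 0] 1 by simp_all
      ultimately show False using second d(1) by blast
    next
      case 2
      with dist have "c ! 2 \<noteq> ?u" "c ! 1 \<noteq> c ! 3" by (simp_all add: nth_eq_iff_index_eq)
      moreover have "c ! 1 \<in> set (neighbours ?u)" "c ! 2 \<in> set (neighbours (c ! 1))"
        "c ! 2 \<in> set (neighbours (c ! 3))" "c ! 3 \<in> set (neighbours ?u)"
        using edge[of 0 1] edge[of 1 2] edge'[of 2 3] edge'[of 3 0] 2 by simp_all
      ultimately show False using d(2) by blast
    next
      case 3
      \<comment> \<open>In a pentagon, \<open>c ! 2\<close> and \<open>c ! 3\<close> are adjacent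
        second neighbours of \<open>c ! 0\<close>, reached through \<open>c ! 1\<close> and
        \<open>c ! 4\<close>.\<close>
      with dist have "c ! 2 \<noteq> ?u" "c ! 3 \<noteq> ?u" by (simp_all add: nth_eq_iff_index_eq)
      moreover have "c ! 1 \<in> set (neighbours ?u)" "c ! 2 \<in> set (neighbours (c ! 1))"
        "c ! 3 \<in> set (neighbours (c ! 2))" "c ! 3 \<in> set (neighbours (c ! 4))"
        "c ! 4 \<in> set (neighbours ?u)"
        using edge[of 0 1] edge[of 1 2] edge[of 2 3] edge'[of 3 4] edge'[of 4 0] 3 by simp_all
      ultimately show False using second d(3) by blast
    qed
  qed
  then show ?thesis
    unfolding girth_def by (auto intro!: Inf_greatest simp: numeral_eq_enat)
qed

lemma simple_graph_edges66: "simple_graph {..<66} edges66"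
  unfolding simple_graph_def edges66_def by (auto simp: card_2_iff dest: neighboursD(1,2))

lemma chromatic_number_edges66: "chromatic_number {..<66} edges66 = 4"
  unfolding chromatic_number_def
proof (rule Least_equality)
  show "\<exists>f. proper_colouring {..<66} edges66 4 f"
    by (intro exI[of _ colour])
      (auto simp: proper_colouring_def edges66_iff colour_less dest: neighboursD(4))
next
  fix k assume "\<exists>f. proper_colouring {..<66} edges66 k f"
  then obtain f where f: "proper_colouring {..<66} edges66 k f" ..
  show "4 \<le> k"
  proof (rule ccontr)
    assume "\<not> 4 \<le> k"
    \<comment> \<open>A colouring with fewer than four colours has all values below 3, so every
      smaller \<open>k\<close> is covered by the case of three colours.\<close>
    show False
    proof (rule not_three_colourable[of f])
      show "f v < 3" if "v < 66" for v
      proof -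
        have "f v < k" using f that by (simp add: proper_colouring_def)
        with \<open>\<not> 4 \<le> k\<close> show ?thesis by simp
      qed
      show "f u \<noteq> f v" if "u < 66" "v \<in> set (neighbours u)" for u v
        using f that neighboursD(1)[OF that] by (simp add: proper_colouring_def edges66_iff)
    qed
  qed
qed

text \<open>Since \<open>LEAST\<close> is unspecified when nothing qualifies, the existence of the
  witness gives the bound its intended meaning.\<close>

theorem theorem6:
  "min_order 6 4 \<le> 66 \<and>
   (\<exists>(V :: nat set) E. simple_graph V E \<and> card V = 66 \<and>
      chromatic_number V E = 4 \<and> 6 \<le> girth V E)"
proof -
  have witness: "\<exists>(V :: nat set) E. simple_graph V E \<and> card V = 66 \<and>
      chromatic_number V E = 4 \<and> 6 \<le> girth V E"
    using simple_graph_edges66 chromatic_number_edges66 girth_edges66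
    by (intro exI[of _ "{..<66}"] exI[of _ edges66]) simp
  then have "min_order 6 4 \<le> 66"
    unfolding min_order_def by (intro Least_le) (simp add: numeral_eq_enat)
  with witness show ?thesis by blast
qed

end
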